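(* Let $\alpha: I\subset\mathbb{R}\to\mathbb{E}^3$ be a unit speed curve with Frenet frame $\{T,N,B\}$ and type-1 Bishop frame $\{T,N_1,N_2\}$, and let $\theta: I\to\mathbb{R}$ be the angle function relating them, so that $$N=\cos\theta\,N_1+\sin\theta\,N_2,\qquad B=-\sin\theta\,N_1+\cos\theta\,N_2 .$$ Let the spinors $\Psi$ and $\phi$ represent the triads $\{N,B,T\}$ and $\{N_1,N_2,T\}$ respectively, i.e. $\overline{\Psi}^{\,t}\Psi=1$, $\overline{\phi}^{\,t}\phi=1$ and $$N+iB=\Psi^t\sigma\Psi,\quad T=-\hat\Psi^{\,t}\sigma\Psi,\qquad N_1+iN_2=\phi^t\sigma\phi,\quad T=-\hat\phi^{\,t}\sigma\phi .$$ Then $$\phi^t\sigma\phi=e^{i\theta}\,(\Psi^t\sigma\Psi),$$ while the tangent vector determined by the two spinors is the same: $-\hat\phi^{\,t}\sigma\phi=T=-\hat\Psi^{\,t}\sigma\Psi$.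
   Context: $\mathbb{E}^3$ is $\mathbb{R}^3$ with the standard flat metric. A spinor is a vector $\psi=\begin{pmatrix}\psi_1\\ \psi_2\end{pmatrix}\in\mathbb{C}^2$ (here depending on $s\in I$); $\overline{\psi}$ is its componentwise complex conjugate, the superscript $t$ denotes transposition, and the mate of $\psi$ is $\hat\psi=\begin{pmatrix}-\overline{\psi_2}\\ \overline{\psi_1}\end{pmatrix}$. The symbol $\sigma=(\sigma_1,\sigma_2,\sigma_3)$ denotes the triple of complex symmetric matrices $$\sigma_1=\begin{pmatrix}1&0\\0&-1\end{pmatrix},\quad \sigma_2=\begin{pmatrix}i&0\\0&i\end{pmatrix},\quad \sigma_3=\begin{pmatrix}0&-1\\-1&0\end{pmatrix},$$ and for spinors $\phi,\psi$ one writes $\phi^t\sigma\psi=(\phi^t\sigma_1\psi,\phi^t\sigma_2\psi,\phi^t\sigma_3\psi)\in\mathbb{C}^3$. The Frenet frame $\{T,N,B\}$ (unit tangent, normal, binormal), with curvature $\kappa$ and torsion $\tau$, satisfies $T'=\kappa N$, $N'=-\kappa T+\tau B$, $B'=-\tau N$. A type-1 Bishop frame along $\alpha$ is a positively oriented orthonormal frame $\{T,N_1,N_2\}$, $T=\alpha'$, satisfying $T'=k_1N_1+k_2N_2$, $N_1'=-k_1T$, $N_2'=-k_2T$ for real functions $k_1,k_2$ (the Bishop curvatures); the angle $\theta$ satisfies $k_1=\kappa\cos\theta$, $k_2=\kappa\sin\theta$, $\theta'=\tau$. *)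

theory Defs
  imports "HOL-Analysis.Analysis"
begin

definition positive_orthonormal :: "real^3 \<Rightarrow> real^3 \<Rightarrow> real^3 \<Rightarrow> bool" where
  "positive_orthonormal u v w \<longleftrightarrow>
     norm u = 1 \<and> norm v = 1 \<and> norm w = 1 \<and>
     u \<bullet> v = 0 \<and> u \<bullet> w = 0 \<and> v \<bullet> w = 0 \<and>
     det (vector [u, v, w] :: real^3^3) > 0"

text \<open>
  Derivatives are taken within the parameter interval, so they are one-sided at any
  endpoint that belongs to it.
\<close>

definition unit_speed_curve :: "real set \<Rightarrow> (real \<Rightarrow> real^3) \<Rightarrow> bool" where
  "unit_speed_curve I \<alpha> \<longleftrightarrow>
     is_interval I \<and> interior I \<noteq> {} \<and>
     (\<forall>s\<in>I. \<alpha> differentiable (at s within I) \<and>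
            norm (vector_derivative \<alpha> (at s within I)) = 1)"

text \<open>The condition \<open>\<kappa> > 0\<close> is what makes the principal normal well defined.\<close>

definition frenet_frame ::
  "real set \<Rightarrow> (real \<Rightarrow> real^3) \<Rightarrow> (real \<Rightarrow> real^3) \<Rightarrow> (real \<Rightarrow> real^3) \<Rightarrow> (real \<Rightarrow> real^3) \<Rightarrow>
   (real \<Rightarrow> real) \<Rightarrow> (real \<Rightarrow> real) \<Rightarrow> bool" where
  "frenet_frame I \<alpha> T N B \<kappa> \<tau> \<longleftrightarrow>
     (\<forall>s\<in>I. (\<alpha> has_vector_derivative T s) (at s within I) \<and>
            positive_orthonormal (T s) (N s) (B s) \<and>
            \<kappa> s > 0 \<and>
            (T has_vector_derivative \<kappa> s *\<^sub>R N s) (at s within I) \<and>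
            (N has_vector_derivative - \<kappa> s *\<^sub>R T s + \<tau> s *\<^sub>R B s) (at s within I) \<and>
            (B has_vector_derivative - \<tau> s *\<^sub>R N s) (at s within I))"

definition bishop_frame ::
  "real set \<Rightarrow> (real \<Rightarrow> real^3) \<Rightarrow> (real \<Rightarrow> real^3) \<Rightarrow> (real \<Rightarrow> real^3) \<Rightarrow> (real \<Rightarrow> real^3) \<Rightarrow>
   (real \<Rightarrow> real) \<Rightarrow> (real \<Rightarrow> real) \<Rightarrow> bool" where
  "bishop_frame I \<alpha> T N\<^sub>1 N\<^sub>2 k\<^sub>1 k\<^sub>2 \<longleftrightarrow>
     (\<forall>s\<in>I. (\<alpha> has_vector_derivative T s) (at s within I) \<and>
            positive_orthonormal (T s) (N\<^sub>1 s) (N\<^sub>2 s) \<and>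
            (T has_vector_derivative k\<^sub>1 s *\<^sub>R N\<^sub>1 s + k\<^sub>2 s *\<^sub>R N\<^sub>2 s) (at s within I) \<and>
            (N\<^sub>1 has_vector_derivative - k\<^sub>1 s *\<^sub>R T s) (at s within I) \<and>
            (N\<^sub>2 has_vector_derivative - k\<^sub>2 s *\<^sub>R T s) (at s within I))"

definition bishop_angle ::
  "real set \<Rightarrow> (real \<Rightarrow> real) \<Rightarrow> (real \<Rightarrow> real) \<Rightarrow> (real \<Rightarrow> real) \<Rightarrow> (real \<Rightarrow> real) \<Rightarrow>
   (real \<Rightarrow> real) \<Rightarrow> bool" where
  "bishop_angle I \<kappa> \<tau> k\<^sub>1 k\<^sub>2 \<theta> \<longleftrightarrow>
     (\<forall>s\<in>I. k\<^sub>1 s = \<kappa> s * cos (\<theta> s) \<and> k\<^sub>2 s = \<kappa> s * sin (\<theta> s) \<and>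
            (\<theta> has_real_derivative \<tau> s) (at s within I))"

type_synonym spinor = "complex^2"

definition mate :: "spinor \<Rightarrow> spinor" where
  "mate \<psi> = vector [- cnj (\<psi>$2), cnj (\<psi>$1)]"

definition sigma1 :: "complex^2^2" where
  "sigma1 = vector [vector [1, 0], vector [0, -1]]"

definition sigma2 :: "complex^2^2" where
  "sigma2 = vector [vector [\<i>, 0], vector [0, \<i>]]"

definition sigma3 :: "complex^2^2" where
  "sigma3 = vector [vector [0, -1], vector [-1, 0]]"

text \<open>
  The product \<open>\<phi>\<^sup>t \<psi>\<close> is complex bilinear. The library's inner product on \<open>complex^2\<close>
  is real-valued, so it cannot be used here.
\<close>

definition tdot :: "spinor \<Rightarrow> spinor \<Rightarrow> complex" where
  "tdot \<phi> \<psi> = (\<Sum>i\<in>UNIV. \<phi>$i * \<psi>$i)"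

definition spinor_conj :: "spinor \<Rightarrow> spinor" where
  "spinor_conj \<psi> = (\<chi> i. cnj (\<psi>$i))"

definition sigma_form :: "spinor \<Rightarrow> spinor \<Rightarrow> complex^3" where
  "sigma_form \<phi> \<psi> =
     vector [tdot \<phi> (sigma1 *v \<psi>), tdot \<phi> (sigma2 *v \<psi>), tdot \<phi> (sigma3 *v \<psi>)]"

definition complexify :: "real^3 \<Rightarrow> complex^3" where
  "complexify v = (\<chi> j. complex_of_real (v$j))"

definition represents_triad :: "spinor \<Rightarrow> real^3 \<Rightarrow> real^3 \<Rightarrow> real^3 \<Rightarrow> bool" where
  "represents_triad \<psi> a b c \<longleftrightarrow>
     tdot (spinor_conj \<psi>) \<psi> = 1 \<and>
     complexify a + \<i> *s complexify b = sigma_form \<psi> \<psi> \<and>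
     complexify c = - sigma_form (mate \<psi>) \<psi>"

end

theory Submission imports Defs begin

text \<open>Turning an orthonormal pair in the normal plane by an angle multiplies the complex
  vector built from it by a unit phase: \<open>N + i B\<close> equals
  \<open>exp (- i \<theta>) (N\<^sub>1 + i N\<^sub>2)\<close>. Each spinor's quadratic form is by
  hypothesis such a vector, so the phase passes to the forms. The tangent is the axis of the
  rotation and is the third vector of both triads, so it acquires no phase.\<close>

lemma complexify_rotated_frame:
  fixes a b :: "real^3" and t :: real
  defines "u \<equiv> cos t *\<^sub>R a + sin t *\<^sub>R b" and "v \<equiv> - sin t *\<^sub>R a + cos t *\<^sub>R b"
  shows "exp (\<i> * complex_of_real t) *s (complexify u + \<i> *s complexify v) =
         complexify a + \<i> *s complexify b"
proof -
  \<comment> \<open>The coefficients of \<open>a\<close> and \<open>b\<close> are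
    \<open>cos t - i sin t\<close> and \<open>sin t + i cos t\<close>, the latter being
    \<open>i\<close> times the former, so \<open>exp (- i t)\<close> factors out. This is checked on
    real and imaginary parts of each coordinate.\<close>
  have "complexify u + \<i> *s complexify v =
        exp (- (\<i> * complex_of_real t)) *s (complexify a + \<i> *s complexify b)"
    by (simp add: vec_eq_iff complexify_def u_def v_def complex_eq_iff Re_exp Im_exp algebra_simps)
  then show ?thesis
    by (simp add: vector_smult_assoc flip: exp_add)
qed

theorem theorem2:
  fixes I :: "real set"
    and \<alpha> T N B N\<^sub>1 N\<^sub>2 :: "real \<Rightarrow> real^3"
    and \<kappa> \<tau> k\<^sub>1 k\<^sub>2 \<theta> :: "real \<Rightarrow> real"
    and \<Psi> \<phi> :: "real \<Rightarrow> spinor"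
  assumes "unit_speed_curve I \<alpha>"
    and "frenet_frame I \<alpha> T N B \<kappa> \<tau>"
    and "bishop_frame I \<alpha> T N\<^sub>1 N\<^sub>2 k\<^sub>1 k\<^sub>2"
    and "bishop_angle I \<kappa> \<tau> k\<^sub>1 k\<^sub>2 \<theta>"
    and "\<And>s. s \<in> I \<Longrightarrow> N s = cos (\<theta> s) *\<^sub>R N\<^sub>1 s + sin (\<theta> s) *\<^sub>R N\<^sub>2 s"
    and "\<And>s. s \<in> I \<Longrightarrow> B s = - sin (\<theta> s) *\<^sub>R N\<^sub>1 s + cos (\<theta> s) *\<^sub>R N\<^sub>2 s"
    and "\<And>s. s \<in> I \<Longrightarrow> represents_triad (\<Psi> s) (N s) (B s) (T s)"
    and "\<And>s. s \<in> I \<Longrightarrow> represents_triad (\<phi> s) (N\<^sub>1 s) (N\<^sub>2 s) (T s)"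
  shows "\<forall>s\<in>I.
           sigma_form (\<phi> s) (\<phi> s) = exp (\<i> * complex_of_real (\<theta> s)) *s sigma_form (\<Psi> s) (\<Psi> s) \<and>
           - sigma_form (mate (\<phi> s)) (\<phi> s) = complexify (T s) \<and>
           complexify (T s) = - sigma_form (mate (\<Psi> s)) (\<Psi> s)"
proof
  fix s assume s: "s \<in> I"
  note \<Psi> = assms(7)[OF s, unfolded represents_triad_def]
  note \<phi> = assms(8)[OF s, unfolded represents_triad_def]
  \<comment> \<open>Both sides equal \<open>N\<^sub>1 + i N\<^sub>2\<close> at \<open>s\<close>: the
    left through \<open>\<phi>\<close>, the right through \<open>\<Psi>\<close> and the rotation
    from the Bishop to the Frenet normals.\<close>
  have "sigma_form (\<phi> s) (\<phi> s) = exp (\<i> * complex_of_real (\<theta> s)) *s sigma_form (\<Psi> s) (\<Psi> s)"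
    using \<Psi> \<phi> complexify_rotated_frame[of "\<theta> s" "N\<^sub>1 s" "N\<^sub>2 s"] assms(5,6)[OF s] by metis
  with \<Psi> \<phi> show "sigma_form (\<phi> s) (\<phi> s) = exp (\<i> * complex_of_real (\<theta> s)) *s sigma_form (\<Psi> s) (\<Psi> s) \<and>
           - sigma_form (mate (\<phi> s)) (\<phi> s) = complexify (T s) \<and>
           complexify (T s) = - sigma_form (mate (\<Psi> s)) (\<Psi> s)"
    by simp
qed

end
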